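(* There are entire functions that are not polynomials and that define a superposition operator on $\mathcal{H}_+$, but not every entire function defines a superposition operator on $\mathcal{H}_+$.
   Context: $\mathcal{H}_{+}$ is the space of Dirichlet series $D=\sum a_nn^{-s}$ with $\sum_n|a_n|^2n^{-2\sigma}<\infty$ for every $\sigma>0$; such series converge absolutely on $\mathbb{C}_{\frac12}=\{s\in\mathbb C:\operatorname{Re}s>\frac12\}$. A function $\varphi:\mathbb{C}\to\mathbb{C}$ defines a superposition operator on $\mathcal{H}_+$ if for every $D\in\mathcal{H}_+$ the function $S_\varphi(D)=\varphi\circ D$ on $\mathbb{C}_{\frac12}$ is given by a Dirichlet series belonging to $\mathcal{H}_+$. *)

theory Defs
  imports "HOL-Complex_Analysis.Complex_Analysis"
begin

text \<open>
  A Dirichlet series is represented by its coefficient sequence; only the indices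
  \<open>n \<ge> 1\<close> are used, the value at \<open>0\<close> is irrelevant.
\<close>

definition H_plus :: "(nat \<Rightarrow> complex) set" where
  "H_plus = {a. \<forall>\<sigma>>0. (\<lambda>n. (cmod (a n))\<^sup>2 * real n powr (- 2 * \<sigma>)) summable_on {1..}}"

text \<open>
  The unordered sum is a faithful value for the series on the half-plane below,
  since series in \<^const>\<open>H_plus\<close> converge absolutely there.
\<close>

definition dirichlet_series :: "(nat \<Rightarrow> complex) \<Rightarrow> complex \<Rightarrow> complex" where
  "dirichlet_series a s = (\<Sum>\<^sub>\<infinity>n\<in>{1..}. a n * of_nat n powr (- s))"

definition half_plane :: "real \<Rightarrow> complex set" where
  "half_plane c = {s. Re s > c}"

definition defines_superposition_operator :: "(complex \<Rightarrow> complex) \<Rightarrow> bool" where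
  "defines_superposition_operator \<phi> \<longleftrightarrow>
     (\<forall>a\<in>H_plus. \<exists>b\<in>H_plus. \<forall>s\<in>half_plane (1/2).
        (\<phi> \<circ> dirichlet_series a) s = dirichlet_series b s)"

end

theory Submission
  imports Defs
begin

text \<open>
  If \<open>\<phi>(z) = \<Sum>\<^sub>k c\<^sub>k z\<^sup>k\<close>, then on the half-plane of absolute convergence \<open>\<phi> \<circ> D\<close> is the Dirichlet series
  with coefficients \<open>\<Sum>\<^sub>k c\<^sub>k a\<^bsup>*k\<^esup>\<close>, where \<open>a\<^bsup>*k\<^esup>\<close> is the \<open>k\<close>-th Dirichlet convolution power; by uniqueness
  these are its only possible coefficients.

  The divisor bound \<open>d(n) = O(n\<^sup>\<epsilon>)\<close> and Cauchy--Schwarz control the square norm of \<open>a\<^bsup>*k\<^esup>\<close> at \<open>\<sigma>\<close> by a constant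
  \<open>K\<close>, depending on \<open>k\<close> and \<open>\<sigma>\<close> only, times the \<open>k\<close>-th power of the square norm of \<open>a\<close> at \<open>\<sigma>/2\<close>. If \<open>c\<^sub>k > 0\<close> decays fast
  enough to beat all these constants, \<open>\<phi>\<close> defines a superposition operator.

  On the other hand let \<open>a\<^sub>n = n powr (-1/2)\<close> and \<open>c\<^sub>k = (k!) powr (-1/4)\<close>. The number \<open>m!\<close> has at least \<open>m!\<close> ordered
  factorizations into \<open>m\<close> factors, namely the permutations of \<open>1, \<dots>, m\<close>, so the coefficient of \<open>\<phi> \<circ> D\<close>
  at \<open>n = m!\<close> is at least \<open>n powr (1/4)\<close>, which is too large for the space.
\<close>

section \<open>Dirichlet convolution\<close>

text \<open>The carrier is polymorphic so that the same convolution serves complex coefficients and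
  their nonnegative real majorants. At n = 0 every d is a divisor, so the infinite index set makes
  the sum 0; the results about single values therefore mostly take n \<ge> 1.\<close>

definition dconv :: "(nat \<Rightarrow> 'a::comm_semiring_1) \<Rightarrow> (nat \<Rightarrow> 'a) \<Rightarrow> nat \<Rightarrow> 'a" where
  "dconv f g n = (\<Sum>d | d dvd n. f d * g (n div d))"

fun dpow :: "(nat \<Rightarrow> 'a::comm_semiring_1) \<Rightarrow> nat \<Rightarrow> nat \<Rightarrow> 'a" where
  "dpow f 0 = (\<lambda>n. if n = 1 then 1 else 0)"
| "dpow f (Suc k) = dconv f (dpow f k)"

lemma dconv_cong:
  assumes "\<And>d. d \<ge> 1 \<Longrightarrow> f d = f' d" "\<And>d. d \<ge> 1 \<Longrightarrow> g d = g' d" "n \<ge> 1"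
  shows "dconv f g n = dconv f' g' n"
  unfolding dconv_def
proof (rule sum.cong)
  fix d assume "d \<in> {d. d dvd n}"
  then obtain e where "n = d * e" by auto
  with assms(3) have "d \<ge> 1" "n div d \<ge> 1" by (auto simp: Suc_le_eq)
  then show "f d * g (n div d) = f' d * g' (n div d)" using assms by simp
qed simp

text \<open>A weight w with w(de) = w(d) w(e) contributes the same factor w(n) to every term of the
  divisor sum. This is how powers of n pass through convolutions.\<close>

lemma dconv_mult:
  assumes "\<And>m n. m \<ge> 1 \<Longrightarrow> n \<ge> 1 \<Longrightarrow> w (m * n) = w m * w n" "n \<ge> 1"
  shows "dconv (\<lambda>n. f n * w n) (\<lambda>n. g n * w n) n = dconv f g n * w n"
  unfolding dconv_def sum_distrib_right
proof (rule sum.cong)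
  fix d assume "d \<in> {d. d dvd n}"
  then obtain e where e: "n = d * e" by auto
  with assms(2) have "d \<ge> 1" "e \<ge> 1" by (auto simp: Suc_le_eq)
  then show "f d * w d * (g (n div d) * w (n div d)) = f d * g (n div d) * w n"
    using assms(1)[of d e] e by (simp add: mult_ac)
qed simp

lemma dpow_mult:
  assumes "\<And>m n. m \<ge> 1 \<Longrightarrow> n \<ge> 1 \<Longrightarrow> w (m * n) = w m * w n" "w 1 = 1" "n \<ge> 1"
  shows "dpow (\<lambda>n. f n * w n) k n = dpow f k n * w n"
  using assms(3)
proof (induction k arbitrary: n)
  case 0
  then show ?case using assms by auto
next
  case (Suc k)
  have "dpow (\<lambda>n. f n * w n) (Suc k) n = dconv (\<lambda>n. f n * w n) (\<lambda>n. dpow f k n * w n) n"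
    using Suc by (auto intro!: dconv_cong)
  also have "\<dots> = dconv f (dpow f k) n * w n"
    by (intro dconv_mult assms Suc.prems)
  finally show ?case by simp
qed

text \<open>The product of two absolutely convergent series is an absolutely convergent double
  series over pairs (d, e); grouping the pairs by their product n = de gives the
  convolution.\<close>

lemma has_sum_dconv:
  fixes f g :: "nat \<Rightarrow> 'a::{real_normed_field, banach}"
  assumes f: "(\<lambda>n. norm (f n)) summable_on {1..}" and g: "(\<lambda>n. norm (g n)) summable_on {1..}"
  shows "(dconv f g has_sum (infsum f {1..} * infsum g {1..})) {1..}"
proof -
  define h where "h = (\<lambda>(m, n). f m * g n)"
  let ?S = "Sigma {1..} (\<lambda>n::nat. {d. d dvd n})"
  have nh: "(\<lambda>x. norm (h x)) summable_on {1..} \<times> {1..}"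
  proof (rule summable_on_SigmaI)
    show "((\<lambda>n. norm (h (m, n))) has_sum (norm (f m) * infsum (\<lambda>n. norm (g n)) {1..})) {1..}" for m
      unfolding h_def using has_sum_cmult_right[OF has_sum_infsum[OF g]] by (simp add: norm_mult)
    show "(\<lambda>m. norm (f m) * infsum (\<lambda>n. norm (g n)) {1..}) summable_on {1..}"
      using f by (rule summable_on_cmult_left)
  qed auto
  then have sh: "h summable_on {1..} \<times> {1..}"
    by (rule Infinite_Sum.abs_summable_summable)
  have "infsum h ({1..} \<times> {1..}) = (\<Sum>\<^sub>\<infinity>m\<in>{1..}. \<Sum>\<^sub>\<infinity>n\<in>{1..}. h (m, n))"
    using infsum_Sigma_banach[OF sh] by simp
  also have "\<dots> = infsum f {1..} * infsum g {1..}"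
    by (simp add: h_def infsum_cmult_right' infsum_cmult_left')
  finally have hs: "(h has_sum (infsum f {1..} * infsum g {1..})) ({1..} \<times> {1..})"
    using has_sum_infsum[OF sh] by simp
  \<comment> \<open>Pairs (d, e) correspond to a number n = de together with a chosen divisor d, so
    summing over the fibres is summing over divisors.\<close>
  have "bij_betw (\<lambda>(n, d). (d, n div d)) ?S ({1..} \<times> {1..})"
    by (rule bij_betw_byWitness[where f' = "\<lambda>(d, e). (d * e, d)"])
       (auto simp: Suc_le_eq elim!: dvdE)
  from has_sum_reindex_bij_betw[OF this, of h] hs
  have "((\<lambda>x. h (case x of (n, d) \<Rightarrow> (d, n div d))) has_sum (infsum f {1..} * infsum g {1..})) ?S"
    by simp
  then show ?thesis
  proof (rule has_sum_SigmaD)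
    fix n :: nat assume "n \<in> {1..}"
    then have "finite {d. d dvd n}" by auto
    then show "((\<lambda>y. h (case (n, y) of (n, d) \<Rightarrow> (d, n div d))) has_sum dconv f g n) {d. d dvd n}"
      by (intro has_sum_finiteI) (auto simp: dconv_def h_def)
  qed
qed

lemma norm_dconv_le:
  fixes f g :: "nat \<Rightarrow> 'a::real_normed_field"
  shows "norm (dconv f g n) \<le> dconv (\<lambda>n. norm (f n)) (\<lambda>n. norm (g n)) n"
  unfolding dconv_def by (rule order_trans[OF norm_sum]) (simp add: norm_mult)

lemma norm_dconv_summable:
  fixes f g :: "nat \<Rightarrow> 'a::{real_normed_field, banach}"
  assumes f: "(\<lambda>n. norm (f n)) summable_on {1..}" and g: "(\<lambda>n. norm (g n)) summable_on {1..}"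
  shows "(\<lambda>n. norm (dconv f g n)) summable_on {1..}"
    and "infsum (\<lambda>n. norm (dconv f g n)) {1..} \<le> infsum (\<lambda>n. norm (f n)) {1..} * infsum (\<lambda>n. norm (g n)) {1..}"
proof -
  have *: "(dconv (\<lambda>n. norm (f n)) (\<lambda>n. norm (g n)) has_sum
     (infsum (\<lambda>n. norm (f n)) {1..} * infsum (\<lambda>n. norm (g n)) {1..})) {1..}"
    using assms by (intro has_sum_dconv) simp_all
  show 1: "(\<lambda>n. norm (dconv f g n)) summable_on {1..}"
    by (rule summable_on_comparison_test[OF has_sum_imp_summable[OF *]]) (auto intro: norm_dconv_le)
  show "infsum (\<lambda>n. norm (dconv f g n)) {1..} \<le> infsum (\<lambda>n. norm (f n)) {1..} * infsum (\<lambda>n. norm (g n)) {1..}"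
    using infsum_mono[OF 1 has_sum_imp_summable[OF *]] infsumI[OF *] by (simp add: norm_dconv_le)
qed

lemma dpow_summable:
  fixes f :: "nat \<Rightarrow> 'a::{real_normed_field, banach}"
  assumes f: "(\<lambda>n. norm (f n)) summable_on {1..}"
  shows "(\<lambda>n. norm (dpow f k n)) summable_on {1..}"
    and "infsum (\<lambda>n. norm (dpow f k n)) {1..} \<le> infsum (\<lambda>n. norm (f n)) {1..} ^ k"
    and "infsum (dpow f k) {1..} = infsum f {1..} ^ k"
proof (induction k)
  case 0
  have n: "((\<lambda>n. norm (dpow f 0 n)) has_sum 1) {1..}"
    by (rule has_sum_finite_neutralI[where B = "{1}"]) auto
  have d: "(dpow f 0 has_sum 1) {1..}"
    by (rule has_sum_finite_neutralI[where B = "{1}"]) auto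
  { case 1 show ?case using n by (rule has_sum_imp_summable) }
  { case 2 show ?case using infsumI[OF n] by simp }
  { case 3 show ?case using infsumI[OF d] by simp }
next
  case (Suc k)
  { case 1 show ?case using norm_dconv_summable(1)[OF f Suc(1)] by simp }
  { case 2
    have "infsum (\<lambda>n. norm (dpow f (Suc k) n)) {1..}
      \<le> infsum (\<lambda>n. norm (f n)) {1..} * infsum (\<lambda>n. norm (dpow f k n)) {1..}"
      using norm_dconv_summable(2)[OF f Suc(1)] by simp
    also have "\<dots> \<le> infsum (\<lambda>n. norm (f n)) {1..} * infsum (\<lambda>n. norm (f n)) {1..} ^ k"
      by (intro mult_left_mono Suc(2) infsum_nonneg) auto
    finally show ?case by simp }
  { case 3 show ?case using infsumI[OF has_sum_dconv[OF f Suc(1)]] Suc(3) by simp }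
qed

text \<open>The double series over (k, n) with terms \<open>c k * dpow f k n\<close> converges
  absolutely, since row k has absolute sum at most |c_k| S^k with S the absolute sum of f. Rows
  first give the power series at the sum of f; columns first give the coefficients of the composed
  series.\<close>

lemma dpow_superposition:
  fixes f :: "nat \<Rightarrow> 'a::{real_normed_field, banach}"
  assumes f: "(\<lambda>n. norm (f n)) summable_on {1..}"
    and c: "\<And>x::real. x \<ge> 0 \<Longrightarrow> summable (\<lambda>k. norm (c k) * x ^ k)"
  shows "n \<ge> 1 \<Longrightarrow> (\<lambda>k. norm (c k * dpow f k n)) summable_on UNIV"
    and "((\<lambda>n. \<Sum>\<^sub>\<infinity>k. c k * dpow f k n) has_sum (\<Sum>k. c k * infsum f {1..} ^ k)) {1..}"
proof -
  define S where "S = infsum (\<lambda>n. norm (f n)) {1..}"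
  have S0: "S \<ge> 0" unfolding S_def by (intro infsum_nonneg) auto
  define h where "h = (\<lambda>(k, n). c k * dpow f k n)"
  have nh: "(\<lambda>x. norm (h x)) summable_on UNIV \<times> {1..}"
  proof (rule summable_on_SigmaI)
    show "((\<lambda>n. norm (h (k, n))) has_sum (norm (c k) * infsum (\<lambda>n. norm (dpow f k n)) {1..})) {1..}" for k
      unfolding h_def using has_sum_cmult_right[OF has_sum_infsum[OF dpow_summable(1)[OF f]]]
      by (simp add: norm_mult)
    have "(\<lambda>k. norm (c k) * S ^ k) summable_on UNIV"
      using c[OF S0] S0 by (subst summable_on_UNIV_nonneg_real_iff) auto
    moreover have "norm (c k) * infsum (\<lambda>n. norm (dpow f k n)) {1..} \<le> norm (c k) * S ^ k" for k
      unfolding S_def by (rule mult_left_mono[OF dpow_summable(2)[OF f]]) simp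
    moreover have "0 \<le> norm (c k) * infsum (\<lambda>n. norm (dpow f k n)) {1..}" for k
      by (intro mult_nonneg_nonneg infsum_nonneg norm_ge_zero)
    ultimately show "(\<lambda>k. norm (c k) * infsum (\<lambda>n. norm (dpow f k n)) {1..}) summable_on UNIV"
      by (rule summable_on_comparison_test)
  qed auto
  have sw: "bij_betw prod.swap ({1::nat..} \<times> (UNIV::nat set)) (UNIV \<times> {1..})"
    by (auto simp: bij_betw_def product_swap)
  have nh': "(\<lambda>x. norm (h (prod.swap x))) summable_on {1..} \<times> UNIV"
    using nh by (subst summable_on_reindex_bij_betw[OF sw, of "\<lambda>x. norm (h x)"])
  have col: "(\<lambda>k. norm (c k * dpow f k n)) summable_on UNIV" if "n \<ge> 1" for n
  proof -
    have "(\<lambda>k. norm (h (prod.swap (n, k)))) summable_on UNIV"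
      by (rule summable_on_SigmaD1[where A = "{1..}"])
         (use nh' that in \<open>auto simp: case_prod_unfold prod.swap_def\<close>)
    then show ?thesis by (simp add: h_def)
  qed
  then show "n \<ge> 1 \<Longrightarrow> (\<lambda>k. norm (c k * dpow f k n)) summable_on UNIV" .
  have sh: "(\<lambda>x. h (prod.swap x)) summable_on {1..} \<times> UNIV"
    using nh' by (rule Infinite_Sum.abs_summable_summable)
  have sh2: "h summable_on UNIV \<times> {1..}"
    using nh by (rule Infinite_Sum.abs_summable_summable)
  have ns: "summable (\<lambda>k. norm (c k * infsum f {1..} ^ k))"
    using c[of "norm (infsum f {1..})"] by (simp add: norm_mult norm_power)
  then have pow: "((\<lambda>k. c k * infsum f {1..} ^ k) has_sum (\<Sum>k. c k * infsum f {1..} ^ k)) UNIV"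
    by (rule norm_summable_imp_has_sum[OF _ summable_sums[OF summable_norm_cancel[OF ns]]])
  have "(\<Sum>\<^sub>\<infinity>k. c k * infsum f {1..} ^ k) = infsum h (UNIV \<times> {1..})"
    using infsum_Sigma_banach[OF sh2]
    by (simp add: h_def infsum_cmult_right' dpow_summable(3)[OF f] del: One_nat_def)
  then have "infsum h (UNIV \<times> {1..}) = (\<Sum>k. c k * infsum f {1..} ^ k)"
    by (simp only: infsumI[OF pow])
  then have "(h has_sum (\<Sum>k. c k * infsum f {1..} ^ k)) (UNIV \<times> {1..})"
    using has_sum_infsum[OF sh2] by simp
  then have "((\<lambda>x. h (prod.swap x)) has_sum (\<Sum>k. c k * infsum f {1..} ^ k)) ({1..} \<times> UNIV)"
    by (simp only: has_sum_reindex_bij_betw[OF sw, of h])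
  then show "((\<lambda>n. \<Sum>\<^sub>\<infinity>k. c k * dpow f k n) has_sum (\<Sum>k. c k * infsum f {1..} ^ k)) {1..}"
  proof (rule has_sum_SigmaD)
    fix n :: nat assume "n \<in> {1..}"
    then have "(\<lambda>k. c k * dpow f k n) summable_on UNIV"
      by (intro Infinite_Sum.abs_summable_summable[OF col]) simp
    then show "((\<lambda>y. h (prod.swap (n, y))) has_sum (\<Sum>\<^sub>\<infinity>k. c k * dpow f k n)) UNIV"
      by (simp add: h_def has_sum_infsum)
  qed
qed

section \<open>The divisor bound and square norms of convolution powers\<close>

lemma card_divisors_prime_power_mult:
  assumes "prime p" "m \<ge> 1"
  shows "card {d. d dvd p ^ k * m} \<le> (k + 1) * card {d. d dvd (m::nat)}"
proof -
  \<comment> \<open>Each divisor of a product splits into divisors of the factors, so the products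
    p^i d cover all divisors, which bounds their number from above.\<close>
  have "{d. d dvd p ^ k * m} \<subseteq> (\<lambda>(i, d). p ^ i * d) ` ({..k} \<times> {d. d dvd m})"
  proof
    fix x assume "x \<in> {d. d dvd p ^ k * m}"
    then obtain b c where x: "x = b * c" "b dvd p ^ k" "c dvd m"
      using division_decomp[of x "p ^ k" m] by auto
    then obtain i where "i \<le> k" "b = p ^ i"
      using divides_primepow_nat[OF assms(1)] by blast
    with x show "x \<in> (\<lambda>(i, d). p ^ i * d) ` ({..k} \<times> {d. d dvd m})" by force
  qed
  moreover have fin: "finite ({..k} \<times> {d. d dvd m})"
    using assms by simp
  ultimately have "card {d. d dvd p ^ k * m} \<le> card ((\<lambda>(i, d). p ^ i * d) ` ({..k} \<times> {d. d dvd m}))"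
    by (intro card_mono) auto
  also have "\<dots> \<le> card ({..k} \<times> {d. d dvd m})"
    using fin by (rule card_image_le)
  finally show ?thesis by (simp add: card_cartesian_product)
qed

text \<open>Full prime powers p^k are stripped off n one at a time. Each costs a factor k + 1, to be
  compared with p^(\<epsilon>k): if p^\<epsilon> \<ge> 2 then k + 1 \<le> 2^k already suffices, and
  otherwise a constant C is paid.\<close>

lemma card_divisors_bound:
  fixes \<epsilon> :: real
  assumes "\<epsilon> > 0"
  obtains K where "K \<ge> 0" "\<And>n. n \<ge> 1 \<Longrightarrow> real (card {d. d dvd n}) \<le> K * real n powr \<epsilon>"
proof -
  \<comment> \<open>From 1 + x \<le> e^x with x = \<epsilon> k ln 2; the two arguments of the
    maximum absorb the summand 1 and the summand k of k + 1.\<close>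
  define C where "C = max 1 (1 / (\<epsilon> * ln 2))"
  have C1: "C \<ge> 1" by (simp add: C_def)
  have C: "real (k + 1) \<le> C * 2 powr (\<epsilon> * real k)" for k
  proof -
    have "1 \<le> C * (\<epsilon> * ln 2)"
    proof -
      have "1 / (\<epsilon> * ln 2) * (\<epsilon> * ln 2) \<le> C * (\<epsilon> * ln 2)"
        using assms by (intro mult_right_mono) (auto simp: C_def)
      then show ?thesis using assms by simp
    qed
    then have "real k * 1 \<le> real k * (C * (\<epsilon> * ln 2))"
      by (intro mult_left_mono) auto
    then have "real (k + 1) \<le> C * (1 + \<epsilon> * real k * ln 2)"
      using C1 by (simp add: algebra_simps)
    also have "\<dots> \<le> C * 2 powr (\<epsilon> * real k)"
      using C1 exp_ge_add_one_self[of "\<epsilon> * real k * ln 2"] by (simp add: powr_def)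
    finally show ?thesis .
  qed
  define P where "P = nat \<lceil>2 powr (1 / \<epsilon>)\<rceil>"
  have P: "2 \<le> real p powr \<epsilon>" if "p \<ge> P" for p
  proof -
    have "2 powr (1 / \<epsilon>) \<le> real p" using that by (simp add: P_def nat_le_iff ceiling_le_iff)
    then have "(2 powr (1 / \<epsilon>)) powr \<epsilon> \<le> real p powr \<epsilon>"
      using assms by (intro powr_mono2) auto
    then show ?thesis using assms by (simp add: powr_powr)
  qed
  define S where "S n = {p. prime p \<and> p < P \<and> p dvd n}" for n
  have finS: "finite (S n)" for n by (rule finite_subset[of _ "{..<P}"]) (auto simp: S_def)
  \<comment> \<open>Only the primes below \<open>P\<close> cost a factor \<open>C\<close>, and there are at most \<open>P\<close> of them.\<close>
  have main: "real (card {d. d dvd n}) \<le> C ^ card (S n) * real n powr \<epsilon>" if "n \<ge> 1" for n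
    using that
  proof (induction n rule: less_induct)
    case (less n)
    show ?case
    proof (cases "n = 1")
      case True
      then show ?thesis using C1 by simp
    next
      case False
      then obtain p where p: "prime p" "p dvd n" using prime_factor_nat by blast
      \<comment> \<open>The whole power of p is removed, so p does not divide m; hence a small prime
        p lies in \<open>S n\<close> but not in \<open>S m\<close>, which frees one factor
        C.\<close>
      define k where "k = multiplicity p n"
      have "n \<noteq> 0" "\<not> is_unit p" using less.prems not_prime_unit p(1) by auto
      then obtain m where nm: "n = p ^ k * m" "\<not> p dvd m"
        unfolding k_def by (rule multiplicity_decompose')
      have k: "k \<ge> 1" using nm p by (cases k) auto
      have m1: "m \<ge> 1" using nm less by (cases m) auto
      have "1 < p ^ k" using prime_gt_1_nat[OF p(1)] k by (intro one_less_power) auto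
      with m1 have mn: "m < n" unfolding nm(1) by (intro n_less_m_mult_n) auto
      have pk0: "real p > 0" using prime_gt_0_nat[OF p(1)] by simp
      have ppow: "(real p powr \<epsilon>) ^ k = real p powr (\<epsilon> * real k)"
        using powr_power[of "real p" \<epsilon> k] pk0 by (simp add: mult.commute)
      have "real n powr \<epsilon> = (real p ^ k) powr \<epsilon> * real m powr \<epsilon>"
        unfolding nm(1) by (simp only: of_nat_mult of_nat_power powr_mult)
      also have "(real p ^ k) powr \<epsilon> = (real p powr \<epsilon>) ^ k"
        by (simp add: powr_realpow[OF pk0, symmetric] powr_powr mult.commute ppow)
      finally have npow: "real n powr \<epsilon> = real p powr (\<epsilon> * real k) * real m powr \<epsilon>"
        by (simp only: ppow)
      have sub: "S m \<subseteq> S n" using nm by (auto simp: S_def)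
      have step: "real (k + 1) * C ^ card (S m) \<le> C ^ card (S n) * real p powr (\<epsilon> * real k)"
      proof (cases "p < P")
        case True
        have "card (S m) < card (S n)"
          by (rule psubset_card_mono[OF finS]) (use sub True p nm in \<open>auto simp: S_def\<close>)
        then have "C * C ^ card (S m) \<le> C ^ card (S n)"
          using C1 power_increasing[of "Suc (card (S m))" "card (S n)" C] by simp
        moreover have "real (k + 1) \<le> C * real p powr (\<epsilon> * real k)"
        proof -
          have "2 powr (\<epsilon> * real k) \<le> real p powr (\<epsilon> * real k)"
            using prime_ge_2_nat[OF p(1)] assms by (intro powr_mono2) auto
          then have "C * 2 powr (\<epsilon> * real k) \<le> C * real p powr (\<epsilon> * real k)"
            using C1 by (intro mult_left_mono) auto
          with C[of k] show ?thesis by linarith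
        qed
        ultimately have "real (k + 1) * C ^ card (S m) \<le> C * real p powr (\<epsilon> * real k) * C ^ card (S m)"
          using C1 by (intro mult_right_mono) auto
        also have "\<dots> = (C * C ^ card (S m)) * real p powr (\<epsilon> * real k)" by simp
        also have "\<dots> \<le> C ^ card (S n) * real p powr (\<epsilon> * real k)"
          by (rule mult_right_mono) (use \<open>C * C ^ card (S m) \<le> C ^ card (S n)\<close> in auto)
        finally show ?thesis .
      next
        case False
        have "real (k + 1) \<le> real (2 ^ k)"
          using less_exp[of k] by (intro of_nat_mono) (simp only: Suc_eq_plus1[symmetric] Suc_le_eq)
        then have "real (k + 1) \<le> 2 ^ k" by simp
        also have "\<dots> \<le> (real p powr \<epsilon>) ^ k"
          using P[of p] False by (intro power_mono) auto
        also have "\<dots> = real p powr (\<epsilon> * real k)"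
          by (rule ppow)
        finally have "real (k + 1) \<le> real p powr (\<epsilon> * real k)" .
        moreover have "C ^ card (S m) \<le> C ^ card (S n)"
          using C1 sub finS by (intro power_increasing card_mono) auto
        ultimately have "real (k + 1) * C ^ card (S m) \<le> real p powr (\<epsilon> * real k) * C ^ card (S n)"
          using C1 by (intro mult_mono) auto
        then show ?thesis by (simp add: mult.commute)
      qed
      have "real (card {d. d dvd n}) \<le> real ((k + 1) * card {d. d dvd m})"
        unfolding nm(1) by (rule of_nat_mono) (rule card_divisors_prime_power_mult[OF p(1) m1])
      also have "\<dots> = real (k + 1) * real (card {d. d dvd m})"
        by (rule of_nat_mult)
      also have "\<dots> \<le> real (k + 1) * (C ^ card (S m) * real m powr \<epsilon>)"
        using less.IH[OF mn m1] by (intro mult_left_mono) auto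
      also have "\<dots> = (real (k + 1) * C ^ card (S m)) * real m powr \<epsilon>" by simp
      also have "\<dots> \<le> (C ^ card (S n) * real p powr (\<epsilon> * real k)) * real m powr \<epsilon>"
        by (rule mult_right_mono[OF step]) auto
      finally show ?thesis by (simp add: npow mult.assoc)
    qed
  qed
  have "card (S n) \<le> P" for n
    using card_mono[of "{..<P}" "S n"] by (auto simp: S_def)
  then have "C ^ card (S n) \<le> C ^ P" for n
    using C1 by (intro power_increasing) auto
  then have "C ^ card (S n) * real n powr \<epsilon> \<le> C ^ P * real n powr \<epsilon>" for n
    by (rule mult_right_mono) auto
  then have "real (card {d. d dvd n}) \<le> C ^ P * real n powr \<epsilon>" if "n \<ge> 1" for n
    using main[OF that] order_trans by blast
  moreover have "C ^ P \<ge> 0" using C1 by simp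
  ultimately show ?thesis using that by blast
qed

section \<open>Weighted square norms of convolutions\<close>

abbreviation sqterm :: "(nat \<Rightarrow> complex) \<Rightarrow> real \<Rightarrow> nat \<Rightarrow> real" where
  "sqterm a \<sigma> n \<equiv> (cmod (a n))\<^sup>2 * real n powr (- 2 * \<sigma>)"

text \<open>This is the square of a weighted l2 norm. A divergent series gets the value 0, so bounds
  on it are always stated together with summability.\<close>

abbreviation sqnorm :: "(nat \<Rightarrow> complex) \<Rightarrow> real \<Rightarrow> real" where
  "sqnorm a \<sigma> \<equiv> infsum (sqterm a \<sigma>) {1..}"

lemma sqterm_antimono:
  assumes "n \<ge> 1" "\<tau> \<le> \<sigma>"
  shows "sqterm a \<sigma> n \<le> sqterm a \<tau> n"
  by (rule mult_left_mono[OF powr_mono]) (use assms in auto)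

lemma sqterm_summable_mono:
  assumes "sqterm a \<tau> summable_on {1..}" "\<tau> \<le> \<sigma>"
  shows "sqterm a \<sigma> summable_on {1..}"
  by (rule summable_on_comparison_test[OF assms(1)]) (use sqterm_antimono assms(2) in auto)

lemma sqnorm_antimono:
  assumes "sqterm a \<tau> summable_on {1..}" "\<tau> \<le> \<sigma>"
  shows "sqnorm a \<sigma> \<le> sqnorm a \<tau>"
  by (rule infsum_mono[OF sqterm_summable_mono[OF assms] assms(1)])
     (use sqterm_antimono assms(2) in auto)

lemma sqnorm_nonneg: "sqnorm a \<sigma> \<ge> 0"
  by (intro infsum_nonneg) auto

text \<open>Cauchy-Schwarz over the divisors of n bounds the squared convolution by d(n) times the
  convolution of the squares. The gap \<sigma> - \<tau> pays for d(n), and the convolution of the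
  squares sums to the product of the two square norms. K is fixed before a and b.\<close>

lemma sqnorm_dconv:
  assumes "\<tau> < \<sigma>"
  obtains K where "K \<ge> 0" "\<And>a b. sqterm a \<tau> summable_on {1..} \<Longrightarrow> sqterm b \<tau> summable_on {1..} \<Longrightarrow>
     sqterm (dconv a b) \<sigma> summable_on {1..} \<and> sqnorm (dconv a b) \<sigma> \<le> K * (sqnorm a \<tau> * sqnorm b \<tau>)"
proof -
  obtain K where K: "K \<ge> 0" "\<And>n. n \<ge> 1 \<Longrightarrow> real (card {d. d dvd n}) \<le> K * real n powr (2 * (\<sigma> - \<tau>))"
    using card_divisors_bound[of "2 * (\<sigma> - \<tau>)"] assms by auto
  have "sqterm (dconv a b) \<sigma> summable_on {1..} \<and> sqnorm (dconv a b) \<sigma> \<le> K * (sqnorm a \<tau> * sqnorm b \<tau>)"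
    if a: "sqterm a \<tau> summable_on {1..}" and b: "sqterm b \<tau> summable_on {1..}" for a b
  proof -
    have hs: "(dconv (sqterm a \<tau>) (sqterm b \<tau>) has_sum (sqnorm a \<tau> * sqnorm b \<tau>)) {1..}"
      using a b by (intro has_sum_dconv) (simp_all add: abs_mult)
    have bd: "sqterm (dconv a b) \<sigma> n \<le> K * dconv (sqterm a \<tau>) (sqterm b \<tau>) n" if n: "n \<ge> 1" for n
    proof -
      define V where "V = dconv (\<lambda>n. (cmod (a n))\<^sup>2) (\<lambda>n. (cmod (b n))\<^sup>2) n"
      have V0: "V \<ge> 0" unfolding V_def dconv_def by (intro sum_nonneg) auto
      have "(cmod (dconv a b n))\<^sup>2 \<le> (\<Sum>d | d dvd n. cmod (a d * b (n div d)))\<^sup>2"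
        unfolding dconv_def by (intro power_mono norm_sum) auto
      also have "\<dots> \<le> (\<Sum>d | d dvd n. (cmod (a d * b (n div d)))\<^sup>2) * real (card {d. d dvd n})"
        by (rule sum_squared_le_sum_of_squares)
      also have "\<dots> = V * real (card {d. d dvd n})"
        by (simp add: V_def dconv_def norm_mult power_mult_distrib)
      also have "\<dots> \<le> V * (K * real n powr (2 * (\<sigma> - \<tau>)))"
        using V0 K(2)[OF n] by (rule mult_left_mono[rotated])
      finally have "sqterm (dconv a b) \<sigma> n \<le> V * (K * real n powr (2 * (\<sigma> - \<tau>))) * real n powr (- 2 * \<sigma>)"
        by (rule mult_right_mono) auto
      also have "\<dots> = K * (V * real n powr (- 2 * \<tau>))"
        using n by (simp add: powr_add[symmetric] algebra_simps)
      also have "V * real n powr (- 2 * \<tau>) = dconv (sqterm a \<tau>) (sqterm b \<tau>) n"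
        unfolding V_def by (rule dconv_mult[symmetric]) (use n in \<open>auto simp: powr_mult\<close>)
      finally show ?thesis .
    qed
    have hs': "((\<lambda>n. K * dconv (sqterm a \<tau>) (sqterm b \<tau>) n) has_sum (K * (sqnorm a \<tau> * sqnorm b \<tau>))) {1..}"
      by (rule has_sum_cmult_right[OF hs])
    have 1: "sqterm (dconv a b) \<sigma> summable_on {1..}"
      by (rule summable_on_comparison_test[OF has_sum_imp_summable[OF hs']]) (use bd in auto)
    moreover have "sqnorm (dconv a b) \<sigma> \<le> K * (sqnorm a \<tau> * sqnorm b \<tau>)"
      by (rule has_sum_mono[OF has_sum_infsum[OF 1] hs']) (use bd in auto)
    ultimately show ?thesis by blast
  qed
  with K(1) that show ?thesis by blast
qed

text \<open>Induction on k with \<sigma> varying, since each further convolution consumes part of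
  the gap above \<tau>. That K does not depend on a is what allows the coefficients of the entire
  function to be chosen in advance.\<close>

lemma sqnorm_dpow:
  assumes "0 < \<tau>" "\<tau> < \<sigma>"
  shows "\<exists>K\<ge>0. \<forall>a. sqterm a \<tau> summable_on {1..} \<longrightarrow>
     sqterm (dpow a k) \<sigma> summable_on {1..} \<and> sqnorm (dpow a k) \<sigma> \<le> K * sqnorm a \<tau> ^ k"
  using assms
proof (induction k arbitrary: \<sigma>)
  case 0
  have "(sqterm (dpow a 0) \<sigma> has_sum 1) {1..}" for a
    by (rule has_sum_finite_neutralI[where B = "{1}"]) auto
  note h = this
  show ?case by (rule exI[of _ 1]) (simp only: infsumI[OF h] has_sum_imp_summable[OF h], simp)
next
  case (Suc k)
  \<comment> \<open>The lower half of the gap is used by the induction hypothesis, the upper half by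
    the one additional convolution.\<close>
  define \<rho> where "\<rho> = (\<tau> + \<sigma>) / 2"
  have r: "\<tau> < \<rho>" "\<rho> < \<sigma>" using Suc.prems by (auto simp: \<rho>_def)
  obtain K where K: "K \<ge> 0" "\<And>a. sqterm a \<tau> summable_on {1..} \<Longrightarrow>
     sqterm (dpow a k) \<rho> summable_on {1..} \<and> sqnorm (dpow a k) \<rho> \<le> K * sqnorm a \<tau> ^ k"
    using Suc.IH[OF Suc.prems(1) r(1)] by blast
  obtain L where L: "L \<ge> 0" "\<And>a b. sqterm a \<rho> summable_on {1..} \<Longrightarrow> sqterm b \<rho> summable_on {1..} \<Longrightarrow>
     sqterm (dconv a b) \<sigma> summable_on {1..} \<and> sqnorm (dconv a b) \<sigma> \<le> L * (sqnorm a \<rho> * sqnorm b \<rho>)"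
    using sqnorm_dconv[OF r(2)] by blast
  have "sqterm (dpow a (Suc k)) \<sigma> summable_on {1..} \<and>
     sqnorm (dpow a (Suc k)) \<sigma> \<le> L * K * sqnorm a \<tau> ^ Suc k"
    if a: "sqterm a \<tau> summable_on {1..}" for a
  proof -
    note a' = sqterm_summable_mono[OF a less_imp_le[OF r(1)]]
    note l = L(2)[OF a' conjunct1[OF K(2)[OF a]]]
    have "sqnorm (dconv a (dpow a k)) \<sigma> \<le> L * (sqnorm a \<rho> * sqnorm (dpow a k) \<rho>)"
      using l by blast
    also have "\<dots> \<le> L * (sqnorm a \<tau> * (K * sqnorm a \<tau> ^ k))"
      using L(1) K(2)[OF a] sqnorm_antimono[OF a less_imp_le[OF r(1)]]
      by (intro mult_left_mono mult_mono sqnorm_nonneg) auto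
    finally show ?thesis using l by (simp add: mult_ac)
  qed
  then show ?case using K(1) L(1) by (intro exI[of _ "L * K"]) simp
qed

section \<open>Superposition of a power series with a Dirichlet series\<close>

lemma nat_powr_mult:
  "of_nat (m * n) powr s = of_nat m powr s * (of_nat n powr s :: complex)"
  by (simp add: powr_times_real)

lemma norm_nat_powr:
  "n \<ge> 1 \<Longrightarrow> cmod (of_nat n powr s) = real n powr Re s"
  by (subst norm_powr_real_powr) auto

lemma summable_on_powr:
  assumes "x < - 1"
  shows "(\<lambda>n. real n powr x) summable_on {1..}"
proof -
  have "(\<lambda>n. real n powr x) summable_on UNIV"
    using assms by (subst summable_on_UNIV_nonneg_real_iff) (auto simp: summable_real_powr_iff)
  then show ?thesis by (rule summable_on_subset_banach) auto
qed

lemma H_plus_abs_summable: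
  assumes "a \<in> H_plus" "Re s > 1 / 2"
  shows "(\<lambda>n. cmod (a n * of_nat n powr (- s))) summable_on {1..}"
proof -
  \<comment> \<open>Half the excess of Re s over 1/2: then 2 (Re s - \<tau>) = Re s + 1/2 > 1, so
    both factors of a_n n^(-\<tau>) times n^(\<tau> - s) are square summable.\<close>
  define \<tau> where "\<tau> = (Re s - 1 / 2) / 2"
  have t: "\<tau> > 0" "- 2 * (Re s - \<tau>) < - 1" using assms by (auto simp: \<tau>_def field_simps)
  have "(\<lambda>n. sqterm a \<tau> n + real n powr (- 2 * (Re s - \<tau>))) summable_on {1..}"
    using assms(1) t by (intro summable_on_add summable_on_powr) (auto simp: H_plus_def)
  then show ?thesis
  proof (rule summable_on_comparison_test)
    fix n :: nat assume n: "n \<in> {1..}"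
    define x y where "x = cmod (a n) * real n powr (- \<tau>)" and "y = real n powr (\<tau> - Re s)"
    have "cmod (a n * of_nat n powr (- s)) = x * y"
      using n by (simp add: x_def y_def norm_mult norm_nat_powr powr_add[symmetric])
    also have "\<dots> \<le> x\<^sup>2 + y\<^sup>2"
    proof -
      have "0 \<le> x * y" by (simp add: x_def y_def)
      then show ?thesis using sum_squares_bound[of x y] by linarith
    qed
    also have "x\<^sup>2 = sqterm a \<tau> n"
      using n by (simp add: x_def power_mult_distrib powr_power)
    also have "y\<^sup>2 = real n powr (- 2 * (Re s - \<tau>))"
      using n by (simp add: y_def powr_power algebra_simps)
    finally show "cmod (a n * of_nat n powr (- s)) \<le> sqterm a \<tau> n + real n powr (- 2 * (Re s - \<tau>))" .
  qed auto
qed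

text \<open>The general superposition result is applied to the terms a_n n^(-s). As n^(-s) is
  completely multiplicative it leaves every convolution power as the same factor, so the
  coefficients found do not depend on s.\<close>

lemma superposition_series:
  fixes c :: "nat \<Rightarrow> complex"
  assumes a: "a \<in> H_plus" and c: "\<And>x::real. x \<ge> 0 \<Longrightarrow> summable (\<lambda>k. cmod (c k) * x ^ k)"
  shows "n \<ge> 1 \<Longrightarrow> (\<lambda>k. cmod (c k * dpow a k n)) summable_on UNIV"
    and "Re s > 1 / 2 \<Longrightarrow> ((\<lambda>n. (\<Sum>\<^sub>\<infinity>k. c k * dpow a k n) * of_nat n powr (- s)) has_sum
           (\<Sum>k. c k * dirichlet_series a s ^ k)) {1..}"
proof -
  have pw: "dpow (\<lambda>n. a n * of_nat n powr (- s)) k n = dpow a k n * of_nat n powr (- s)"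
    if "n \<ge> 1" for k n s
    by (rule dpow_mult) (use that nat_powr_mult in auto)
  show "(\<lambda>k. cmod (c k * dpow a k n)) summable_on UNIV" if n: "n \<ge> 1"
  proof -
    \<comment> \<open>The claim does not involve s; it is obtained at the sample point s = 1 and the
      positive weight 1/n is then cancelled.\<close>
    have "(\<lambda>k. cmod (c k * dpow (\<lambda>n. a n * of_nat n powr (- 1)) k n)) summable_on UNIV"
      by (rule dpow_superposition(1)[OF H_plus_abs_summable[OF a] c n]) auto
    also have "(\<lambda>k. cmod (c k * dpow (\<lambda>n. a n * of_nat n powr (- 1)) k n)) =
       (\<lambda>k. cmod (c k * dpow a k n) * real n powr (- 1))"
      using n by (simp only: pw norm_mult norm_nat_powr) (simp add: mult_ac)
    finally have "(\<lambda>k. cmod (c k * dpow a k n) * real n powr (- 1) * real n) summable_on UNIV"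
      by (rule summable_on_cmult_left)
    then show ?thesis using n by (simp add: powr_minus field_simps)
  qed
  show "((\<lambda>n. (\<Sum>\<^sub>\<infinity>k. c k * dpow a k n) * of_nat n powr (- s)) has_sum
           (\<Sum>k. c k * dirichlet_series a s ^ k)) {1..}" if s: "Re s > 1 / 2"
  proof -
    have "((\<lambda>n. \<Sum>\<^sub>\<infinity>k. c k * dpow (\<lambda>n. a n * of_nat n powr (- s)) k n) has_sum
           (\<Sum>k. c k * dirichlet_series a s ^ k)) {1..}"
      using dpow_superposition(2)[OF H_plus_abs_summable[OF a s] c]
      by (simp add: dirichlet_series_def)
    also have "?this \<longleftrightarrow> ?thesis"
    proof (rule has_sum_cong)
      fix n :: nat assume "n \<in> {1..}"
      then have "(\<Sum>\<^sub>\<infinity>k. c k * dpow (\<lambda>n. a n * of_nat n powr (- s)) k n)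
        = (\<Sum>\<^sub>\<infinity>k. (c k * dpow a k n) * of_nat n powr (- s))"
        by (simp add: pw mult.assoc)
      also have "\<dots> = (\<Sum>\<^sub>\<infinity>k. c k * dpow a k n) * of_nat n powr (- s)"
        by (rule infsum_cmult_left')
      finally show "(\<Sum>\<^sub>\<infinity>k. c k * dpow (\<lambda>n. a n * of_nat n powr (- s)) k n)
        = (\<Sum>\<^sub>\<infinity>k. c k * dpow a k n) * of_nat n powr (- s)" .
    qed
    finally show ?thesis .
  qed
qed

lemma entire_power_series:
  fixes c :: "nat \<Rightarrow> complex"
  assumes "\<And>x::real. x \<ge> 0 \<Longrightarrow> summable (\<lambda>k. cmod (c k) * x ^ k)"
  shows "(\<lambda>z. \<Sum>k. c k * z ^ k) holomorphic_on UNIV"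
    and "(\<lambda>k. c k * z ^ k) sums (\<Sum>k. c k * z ^ k)"
proof -
  have s: "(\<lambda>k. c k * z ^ k) sums (\<Sum>k. c k * z ^ k)" for z
    by (rule summable_sums, rule summable_norm_cancel)
       (use assms[of "cmod z"] in \<open>simp add: norm_mult norm_power\<close>)
  then show "(\<lambda>k. c k * z ^ k) sums (\<Sum>k. c k * z ^ k)" .
  have "(\<lambda>z. \<Sum>k. c k * z ^ k) holomorphic_on ball 0 r" for r
    by (rule power_series_holomorphic[where a = c]) (use s in simp)
  then have "(\<lambda>z. \<Sum>k. c k * z ^ k) analytic_on ball 0 r" for r
    by (simp add: analytic_on_open)
  then have "(\<lambda>z. \<Sum>k. c k * z ^ k) analytic_on (\<Union>r. ball 0 r)"
    by (simp add: analytic_on_Union analytic_on_UN)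
  moreover have "(\<Union>r. ball (0::complex) r) = UNIV"
    by (auto intro: gt_ex)
  ultimately show "(\<lambda>z. \<Sum>k. c k * z ^ k) holomorphic_on UNIV"
    by (metis analytic_imp_holomorphic)
qed

text \<open>The weight is split as c x = sqrt c (sqrt c x); the finite inequality bounds all partial
  sums by the same number, hence also the infinite sum.\<close>

lemma infsum_Cauchy_Schwarz:
  fixes c x :: "'a \<Rightarrow> real"
  assumes "\<And>k. k \<in> A \<Longrightarrow> c k \<ge> 0" "c summable_on A" "(\<lambda>k. c k * (x k)\<^sup>2) summable_on A"
    "(\<lambda>k. c k * x k) summable_on A" "\<And>k. k \<in> A \<Longrightarrow> x k \<ge> 0"
  shows "(\<Sum>\<^sub>\<infinity>k\<in>A. c k * x k)\<^sup>2 \<le> infsum c A * (\<Sum>\<^sub>\<infinity>k\<in>A. c k * (x k)\<^sup>2)"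
proof -
  let ?R = "infsum c A * (\<Sum>\<^sub>\<infinity>k\<in>A. c k * (x k)\<^sup>2)"
  have "(\<Sum>\<^sub>\<infinity>k\<in>A. c k * x k) \<le> sqrt ?R"
  proof (rule infsum_le_finite_sums[OF assms(4)])
    fix F assume F: "finite F" "F \<subseteq> A"
    have "(\<Sum>k\<in>F. c k * x k)\<^sup>2 = (\<Sum>k\<in>F. sqrt (c k) * (sqrt (c k) * x k))\<^sup>2"
      using F assms(1) by (intro arg_cong[where f = "\<lambda>x. x\<^sup>2"] sum.cong) (auto simp: mult.assoc[symmetric])
    also have "\<dots> \<le> (\<Sum>k\<in>F. (sqrt (c k))\<^sup>2) * (\<Sum>k\<in>F. (sqrt (c k) * x k)\<^sup>2)"
      by (rule Cauchy_Schwarz_ineq_sum)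
    also have "\<dots> = (\<Sum>k\<in>F. c k) * (\<Sum>k\<in>F. c k * (x k)\<^sup>2)"
      using F assms(1) by (intro arg_cong2[where f = "(*)"] sum.cong) (auto simp: power_mult_distrib)
    also have "\<dots> \<le> ?R"
      using F assms by (intro mult_mono finite_sum_le_infsum sum_nonneg infsum_nonneg) auto
    finally show "(\<Sum>k\<in>F. c k * x k) \<le> sqrt ?R" by (rule real_le_rsqrt)
  qed
  moreover have "0 \<le> (\<Sum>\<^sub>\<infinity>k\<in>A. c k * x k)" using assms by (intro infsum_nonneg) auto
  moreover have "0 \<le> ?R" using assms by (intro mult_nonneg_nonneg infsum_nonneg) auto
  ultimately show ?thesis by (metis power_mono real_sqrt_pow2)
qed

section \<open>A non-polynomial entire function with superposition\<close>

text \<open>Cauchy-Schwarz in k with weights c_k bounds the squared coefficient at n by (\<Sum> c_k)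
  times \<Sum> c_k |\<open>dpow a k n\<close>|^2. Summing over n first turns the second factor into
  the convergent series of hypothesis \<open>s\<close>.\<close>

lemma sqnorm_superposition:
  fixes c :: "nat \<Rightarrow> real"
  assumes c: "\<And>k. c k \<ge> 0" "summable c"
    and a: "\<And>k. sqterm (dpow a k) \<sigma> summable_on {1..}"
    and s: "summable (\<lambda>k. c k * sqnorm (dpow a k) \<sigma>)"
    and abs: "\<And>n. n \<ge> 1 \<Longrightarrow> (\<lambda>k. cmod (of_real (c k) * dpow a k n)) summable_on UNIV"
  shows "sqterm (\<lambda>n. \<Sum>\<^sub>\<infinity>k. of_real (c k) * dpow a k n) \<sigma> summable_on {1..}"
proof -
  define h where "h = (\<lambda>(k, n). c k * sqterm (dpow a k) \<sigma> n)"
  have h: "h summable_on UNIV \<times> {1..}"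
  proof (rule summable_on_SigmaI)
    show "((\<lambda>n. h (k, n)) has_sum (c k * sqnorm (dpow a k) \<sigma>)) {1..}" for k
      unfolding h_def using has_sum_cmult_right[OF has_sum_infsum[OF a]] by simp
    show "(\<lambda>k. c k * sqnorm (dpow a k) \<sigma>) summable_on UNIV"
      using s c sqnorm_nonneg by (subst summable_on_UNIV_nonneg_real_iff) (auto intro!: mult_nonneg_nonneg)
  qed (use c in \<open>auto simp: h_def\<close>)
  have sw: "bij_betw prod.swap ({1::nat..} \<times> (UNIV::nat set)) (UNIV \<times> {1..})"
    by (auto simp: bij_betw_def product_swap)
  have h': "(\<lambda>x. h (prod.swap x)) summable_on {1..} \<times> UNIV"
    using h by (subst summable_on_reindex_bij_betw[OF sw, of h])
  have row: "(\<lambda>k. h (k, n)) summable_on UNIV" if "n \<ge> 1" for n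
  proof -
    have "(\<lambda>k. h (prod.swap (n, k))) summable_on UNIV"
      by (rule summable_on_SigmaD1[where A = "{1..}"])
         (use h' that in \<open>auto simp: case_prod_unfold prod.swap_def\<close>)
    then show ?thesis by simp
  qed
  have "(\<lambda>n. infsum (\<lambda>k. h (prod.swap (n, k))) UNIV) summable_on {1..}"
    by (rule summable_on_SigmaD[OF h']) (use row in auto)
  then have "(\<lambda>n. infsum c UNIV * infsum (\<lambda>k. h (k, n)) UNIV) summable_on {1..}"
    by (intro summable_on_cmult_right) simp
  then show ?thesis
  proof (rule summable_on_comparison_test)
    fix n :: nat assume "n \<in> {1..}"
    then have n: "n \<ge> 1" by simp
    let ?w = "real n powr (- 2 * \<sigma>)"
    have w: "?w > 0" using n by simp
    have eq: "(\<lambda>k. h (k, n)) = (\<lambda>k. c k * (cmod (dpow a k n))\<^sup>2 * ?w)"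
      by (simp add: h_def mult.assoc)
    have "(\<lambda>k. c k * (cmod (dpow a k n))\<^sup>2 * ?w * inverse ?w) summable_on UNIV"
      using row[OF n] unfolding eq by (rule summable_on_cmult_left)
    then have sq: "(\<lambda>k. c k * (cmod (dpow a k n))\<^sup>2) summable_on UNIV"
      using w by (simp add: mult.assoc)
    have cs: "c summable_on UNIV" using c by (subst summable_on_UNIV_nonneg_real_iff) auto
    have ab: "(\<lambda>k. c k * cmod (dpow a k n)) summable_on UNIV"
      using abs[OF n] c(1) by (simp add: norm_mult)
    have "cmod (\<Sum>\<^sub>\<infinity>k. of_real (c k) * dpow a k n) \<le> (\<Sum>\<^sub>\<infinity>k. c k * cmod (dpow a k n))"
      using norm_infsum_bound[OF abs[OF n]] c(1) by (simp add: norm_mult)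
    then have "(cmod (\<Sum>\<^sub>\<infinity>k. of_real (c k) * dpow a k n))\<^sup>2 \<le> (\<Sum>\<^sub>\<infinity>k. c k * cmod (dpow a k n))\<^sup>2"
      by (rule power_mono) simp
    also have "\<dots> \<le> infsum c UNIV * (\<Sum>\<^sub>\<infinity>k. c k * (cmod (dpow a k n))\<^sup>2)"
      by (rule infsum_Cauchy_Schwarz[OF _ cs sq ab]) (use c in auto)
    finally have "sqterm (\<lambda>n. \<Sum>\<^sub>\<infinity>k. of_real (c k) * dpow a k n) \<sigma> n
        \<le> infsum c UNIV * (\<Sum>\<^sub>\<infinity>k. c k * (cmod (dpow a k n))\<^sup>2) * ?w"
      by (rule mult_right_mono) auto
    also have "\<dots> = infsum c UNIV * infsum (\<lambda>k. h (k, n)) UNIV"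
      unfolding eq infsum_cmult_left' by (rule mult.assoc)
    finally show "sqterm (\<lambda>n. \<Sum>\<^sub>\<infinity>k. of_real (c k) * dpow a k n) \<sigma> n
        \<le> infsum c UNIV * infsum (\<lambda>k. h (k, n)) UNIV" .
  qed auto
qed

lemma entire_nonpolynomial_superposition:
  "\<exists>\<phi>. \<phi> holomorphic_on UNIV \<and> (\<nexists>p. \<phi> = poly p) \<and> defines_superposition_operator \<phi>"
proof -
  \<comment> \<open>Countably many scales \<sigma> = 1/(m+1), each with \<tau> = \<sigma>/2,
    suffice: they tend to 0, and summability at one \<sigma> passes to all larger ones.\<close>
  define good where "good K k m \<longleftrightarrow> K \<ge> 0 \<and> (\<forall>a. sqterm a (1 / (2 * real (m + 1))) summable_on {1..} \<longrightarrow>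
      sqterm (dpow a k) (1 / real (m + 1)) summable_on {1..} \<and>
      sqnorm (dpow a k) (1 / real (m + 1)) \<le> K * sqnorm a (1 / (2 * real (m + 1))) ^ k)" for K k m
  have "\<exists>K. good K k m" for k m
    using sqnorm_dpow[of "1 / (2 * real (m + 1))" "1 / real (m + 1)" k]
    by (auto simp: good_def field_simps)
  then obtain K where K: "\<And>k m. good (K k m) k m" by metis
  then have K0: "K k m \<ge> 0" for k m by (simp add: good_def)
  \<comment> \<open>The factorial makes the power series entire; the finite sum collects the
    constants of all scales up to k.\<close>
  define c where "c k = 1 / (fact k * (1 + (\<Sum>m\<le>k. K k m)))" for k
  have D: "1 + (\<Sum>m\<le>k. K k m) \<ge> 1" for k using K0 by (simp add: sum_nonneg)
  have c0: "c k > 0" for k using D[of k] by (simp add: c_def)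
  have c1: "c k \<le> 1 / fact k" for k
    unfolding c_def using D[of k] by (intro divide_left_mono) auto
  \<comment> \<open>Diagonal choice: for each fixed \<open>m\<close>, the weight \<open>c k\<close> absorbs the constant \<open>K k m\<close> as soon as \<open>k \<ge> m\<close>.\<close>
  have cK: "c k * K k m \<le> 1 / fact k" if "m \<le> k" for k m
  proof -
    have "K k m \<le> (\<Sum>m\<le>k. K k m)" using that K0 by (intro member_le_sum) auto
    then have "K k m \<le> 1 + (\<Sum>m\<le>k. K k m)" by simp
    then have "K k m / (1 + (\<Sum>m\<le>k. K k m)) \<le> 1" using D[of k] by simp
    then have "K k m / (1 + (\<Sum>m\<le>k. K k m)) / fact k \<le> 1 / fact k" by (rule divide_right_mono) simp
    then show ?thesis by (simp add: c_def mult.commute)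
  qed
  have sexp: "summable (\<lambda>k. 1 / fact k * x ^ k)" for x :: real
    using summable_exp[of x] by (simp add: field_simps)
  have c_entire: "summable (\<lambda>k. cmod (of_real (c k)) * x ^ k)" if "x \<ge> 0" for x
  proof (rule summable_comparison_test'[OF sexp[of x]])
    show "norm (cmod (of_real (c k)) * x ^ k) \<le> 1 / fact k * x ^ k" for k
      using that c0[of k] c1[of k] mult_right_mono[OF c1[of k], of "x ^ k"] by (simp add: abs_mult)
  qed
  define \<phi> where "\<phi> = (\<lambda>z::complex. \<Sum>k. of_real (c k) * z ^ k)"
  have "\<phi> \<noteq> poly p" for p
  proof
    assume p: "\<phi> = poly p"
    have "(\<lambda>k. (of_real (c k) - coeff p k) * z ^ k) sums 0" for z
    proof -
      have "(\<lambda>k. coeff p k * z ^ k) sums poly p z"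
        unfolding poly_altdef by (rule sums_finite) (auto simp: coeff_eq_0)
      moreover have "(\<lambda>k. of_real (c k) * z ^ k) sums poly p z"
        using entire_power_series(2)[OF c_entire, of z] p by (metis \<phi>_def)
      ultimately show ?thesis using sums_diff by (fastforce simp: left_diff_distrib)
    qed
    \<comment> \<open>Just above the degree of p the difference series has a positive coefficient,
      so it cannot vanish on a punctured disc around 0, although it sums to 0 everywhere.\<close>
    moreover have "of_real (c (Suc (degree p))) - coeff p (Suc (degree p)) \<noteq> 0"
      using c0[of "Suc (degree p)"] by (simp add: coeff_eq_0)
    ultimately obtain s :: real where "0 < s" "\<And>z::complex. z \<in> cball 0 s - {0} \<Longrightarrow> (\<lambda>_. 0::complex) z \<noteq> 0"
      using powser_0_nonzero[of 1 0 "\<lambda>k. of_real (c k) - coeff p k" "\<lambda>_. 0" "Suc (degree p)"] by auto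
    from this(2)[of "of_real s"] this(1) show False by simp
  qed
  moreover have "defines_superposition_operator \<phi>"
    unfolding defines_superposition_operator_def
  proof
    fix a assume a: "a \<in> H_plus"
    define b where "b = (\<lambda>n. \<Sum>\<^sub>\<infinity>k. of_real (c k) * dpow a k n)"
    have "sqterm b \<sigma> summable_on {1..}" if \<sigma>: "\<sigma> > 0" for \<sigma>
    proof -
      obtain m where m: "1 / real (m + 1) < \<sigma>"
        using reals_Archimedean[OF \<sigma>] by (auto simp: inverse_eq_divide)
      define M where "M = sqnorm a (1 / (2 * real (m + 1)))"
      have "1 / (2 * real (m + 1)) > 0" by simp
      then have "sqterm a (1 / (2 * real (m + 1))) summable_on {1..}"
        using a unfolding H_plus_def by blast
      then have pw: "sqterm (dpow a k) (1 / real (m + 1)) summable_on {1..}"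
        "sqnorm (dpow a k) (1 / real (m + 1)) \<le> K k m * M ^ k" for k
        using K[of k m] unfolding good_def M_def by blast+
      have M0: "M \<ge> 0" unfolding M_def by (rule sqnorm_nonneg)
      have "sqterm b (1 / real (m + 1)) summable_on {1..}"
        unfolding b_def
      proof (rule sqnorm_superposition)
        show "c k \<ge> 0" for k using c0[of k] by simp
        show "summable c" using c_entire[of 1] c0 by (simp add: less_imp_le)
        show "summable (\<lambda>k. c k * sqnorm (dpow a k) (1 / real (m + 1)))"
        proof (rule summable_comparison_test'[OF sexp[of M]])
          fix k assume k: "m \<le> k"
          have "c k * sqnorm (dpow a k) (1 / real (m + 1)) \<le> c k * (K k m * M ^ k)"
            using pw(2)[of k] c0[of k] by (intro mult_left_mono) auto
          also have "\<dots> \<le> 1 / fact k * M ^ k"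
            using mult_right_mono[OF cK[OF k], of "M ^ k"] M0 by (simp add: mult.assoc)
          finally show "norm (c k * sqnorm (dpow a k) (1 / real (m + 1))) \<le> 1 / fact k * M ^ k"
            using c0[of k] sqnorm_nonneg[of "dpow a k" "1 / real (m + 1)"] by (simp only: real_norm_def abs_mult abs_of_pos abs_of_nonneg)
        qed
      qed (use pw superposition_series(1)[OF a c_entire] in auto)
      then show ?thesis by (rule sqterm_summable_mono) (use m in simp)
    qed
    then have "b \<in> H_plus" by (simp add: H_plus_def)
    moreover have "(\<phi> \<circ> dirichlet_series a) s = dirichlet_series b s" if "s \<in> half_plane (1 / 2)" for s
      using infsumI[OF superposition_series(2)[OF a c_entire, of s]] that
      by (simp add: half_plane_def \<phi>_def b_def dirichlet_series_def)
    ultimately show "\<exists>b\<in>H_plus. \<forall>s\<in>half_plane (1 / 2). (\<phi> \<circ> dirichlet_series a) s = dirichlet_series b s"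
      by blast
  qed
  moreover have "\<phi> holomorphic_on UNIV"
    unfolding \<phi>_def by (rule entire_power_series(1)[OF c_entire])
  ultimately show ?thesis by blast
qed

section \<open>Lower bounds through uniqueness of coefficients\<close>

text \<open>If all earlier coefficients vanish, the N-th term equals minus the tail. At s = 1 + k
  the tail is O((N+1)^(-k)) while the N-th term is a multiple of N^(-k), so letting k grow forces
  the coefficient to be 0.\<close>

lemma dirichlet_series_eq_0_imp:
  assumes abs: "\<And>s::real. s \<ge> 1 \<Longrightarrow> (\<lambda>n. cmod (c n * of_nat n powr (- of_real s))) summable_on {1..}"
    and zero: "\<And>s::real. s \<ge> 1 \<Longrightarrow> dirichlet_series c (of_real s) = 0"
    and "n \<ge> 1"
  shows "c n = 0"
  using assms(3)
proof (induction n rule: less_induct)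
  case (less N)
  define g where "g = (\<lambda>n. cmod (c n * of_nat n powr (- 1)))"
  have gs: "g summable_on {1..}" unfolding g_def using abs[of 1] by simp
  \<comment> \<open>The absolute tail at s = 1 serves as one constant for all k: moving to s = 1 + k
    divides each of its terms by at least (N+1)^k.\<close>
  define G where "G = infsum g {Suc N..}"
  have gs': "g summable_on {Suc N..}" by (rule summable_on_subset_banach[OF gs]) auto
  have bd: "cmod (c N) \<le> real N * G * (real N / real (N + 1)) ^ k" for k
  proof -
    define s where "s = 1 + real k"
    define f where "f = (\<lambda>n. c n * of_nat n powr (- of_real s))"
    have fs: "(\<lambda>n. cmod (f n)) summable_on {1..}"
      unfolding f_def using abs[of s] by (simp add: s_def)
    have fs': "(\<lambda>n. cmod (f n)) summable_on {Suc N..}"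
      by (rule summable_on_subset_banach[OF fs]) auto
    have nf: "cmod (f n) = g n / real n ^ k" if "n \<ge> 1" for n
    proof -
      have "real n powr (- s) = real n powr (- 1) / real n ^ k"
        using that by (simp add: s_def powr_realpow[symmetric] powr_diff powr_minus field_simps)
      then show ?thesis
        unfolding f_def g_def norm_mult using that norm_nat_powr[of n "- of_real s"] norm_nat_powr[of n "- 1"]
        by simp
    qed
    have "0 = infsum f {1..}"
      using zero[of s] by (simp add: dirichlet_series_def f_def s_def)
    also have "\<dots> = infsum f {N..}"
      by (rule infsum_cong_neutral) (use less in \<open>auto simp: f_def\<close>)
    also have "{N..} = {N} \<union> {Suc N..}" by auto
    also have "infsum f ({N} \<union> {Suc N..}) = infsum f {N} + infsum f {Suc N..}"
      by (rule infsum_Un_disjoint) (use Infinite_Sum.abs_summable_summable[OF fs'] in auto)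
    finally have "f N = - infsum f {Suc N..}" by (simp add: eq_neg_iff_add_eq_0)
    then have "cmod (f N) \<le> infsum (\<lambda>n. cmod (f n)) {Suc N..}"
      using norm_infsum_bound[OF fs'] by simp
    also have "\<dots> \<le> infsum (\<lambda>n. g n * (1 / real (N + 1) ^ k)) {Suc N..}"
    proof (rule infsum_mono[OF fs' summable_on_cmult_left[OF gs']])
      fix n assume n: "n \<in> {Suc N..}"
      then have "g n / real n ^ k \<le> g n / real (N + 1) ^ k"
        by (intro divide_left_mono power_mono) (auto simp: g_def)
      with n show "cmod (f n) \<le> g n * (1 / real (N + 1) ^ k)" by (simp add: nf)
    qed
    also have "\<dots> = G / real (N + 1) ^ k"
      by (simp only: G_def infsum_cmult_left') simp
    finally have "g N / real N ^ k \<le> G / real (N + 1) ^ k" using nf less.prems by simp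
    then have "g N \<le> G / real (N + 1) ^ k * real N ^ k"
      using less.prems by (simp add: pos_divide_le_eq)
    moreover have "cmod (c N) = real N * g N"
      unfolding g_def norm_mult using less.prems norm_nat_powr[of N "- 1"] by (simp add: powr_minus)
    ultimately show ?thesis
      using mult_left_mono[of "g N" "G / real (N + 1) ^ k * real N ^ k" "real N"] by (simp add: power_divide)
  qed
  have "(\<lambda>k. real N * G * (real N / real (N + 1)) ^ k) \<longlonglongrightarrow> real N * G * 0"
    by (intro tendsto_intros LIMSEQ_realpow_zero) auto
  then have "cmod (c N) \<le> real N * G * 0"
    by (rule LIMSEQ_le_const) (use bd in blast)
  then show ?case by simp
qed

section \<open>Counting ordered factorizations\<close>

lemma dpow_ge_0: "(\<And>n. f n \<ge> (0::real)) \<Longrightarrow> dpow f k n \<ge> 0"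
  by (induction k arbitrary: n) (auto simp: dconv_def intro!: sum_nonneg)

text \<open>The k-th convolution power of the constant 1 counts ordered factorizations into k
  factors, and each ordering of S is one for its product. The induction picks the first factor d in
  S and orders the rest, which is why S is a general set.\<close>

lemma fact_le_dpow_one_prod:
  assumes "finite S" "\<And>x. x \<in> S \<Longrightarrow> x \<ge> 1"
  shows "fact (card S) \<le> dpow (\<lambda>_. 1 :: real) (card S) (\<Prod>S)"
  using assms
proof (induction "card S" arbitrary: S)
  case 0
  then show ?case by simp
next
  case (Suc k)
  have P: "\<Prod>S \<noteq> 0" using Suc.prems by (auto simp: prod_zero_iff)
  have "fact (card S) = (\<Sum>d\<in>S. fact k :: real)"
    by (simp add: Suc.hyps(2)[symmetric])
  also have "\<dots> \<le> (\<Sum>d\<in>S. dpow (\<lambda>_. 1) k (\<Prod>S div d))"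
  proof (rule sum_mono)
    fix d assume d: "d \<in> S"
    have "\<Prod>S = d * \<Prod>(S - {d})" using Suc.prems d by (simp add: prod.remove)
    moreover have "d \<ge> 1" using Suc.prems d by blast
    ultimately have "\<Prod>S div d = \<Prod>(S - {d})" by simp
    moreover have "k = card (S - {d})" using Suc.hyps(2) d Suc.prems by simp
    ultimately show "fact k \<le> dpow (\<lambda>_. 1 :: real) k (\<Prod>S div d)"
      using Suc.hyps(1)[of "S - {d}"] Suc.prems by simp
  qed
  also have "\<dots> \<le> (\<Sum>d | d dvd \<Prod>S. dpow (\<lambda>_. 1) k (\<Prod>S div d))"
  proof (intro sum_mono2 dpow_ge_0)
    show "finite {d. d dvd \<Prod>S}" using P by (intro finite_divisors_nat) simp
  qed (use Suc.prems in \<open>auto intro: dvd_prodI\<close>)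
  also have "\<dots> = dpow (\<lambda>_. 1) (card S) (\<Prod>S)"
    by (simp add: Suc.hyps(2)[symmetric] dconv_def)
  finally show ?case .
qed

lemma fact_le_dpow_one_fact: "fact m \<le> dpow (\<lambda>_. 1 :: real) m (fact m)"
  using fact_le_dpow_one_prod[of "{1..m}"] by (simp add: fact_prod)

lemma dpow_of_real:
  "dpow (\<lambda>n. of_real (f n)) k n = (of_real (dpow f k n) :: 'a::real_normed_field)"
  by (induction k arbitrary: n) (simp_all add: dconv_def)

lemma summable_fact_powr:
  fixes x :: real
  assumes "x \<ge> 0"
  shows "summable (\<lambda>k. fact k powr (- 1 / 4) * x ^ k)"
proof (rule summable_ratio_test[where c = "1 / 2"])
  \<comment> \<open>Consecutive terms have ratio x (n+1)^(-1/4), which is at most 1/2 as soon as n +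
    1 \<ge> (2x)^4.\<close>
  fix n assume n: "nat \<lceil>(2 * x) ^ 4\<rceil> \<le> n"
  then have "(2 * x) ^ 4 \<le> real (Suc n)" by linarith
  then have "((2 * x) ^ 4) powr (1 / 4) \<le> real (Suc n) powr (1 / 4)"
    by (intro powr_mono2) auto
  moreover have "((2 * x) ^ 4) powr (1 / 4) = 2 * x"
    using assms root_powr_inverse[of 4 "(2 * x) ^ 4"] real_root_power_cancel[of 4 "2 * x"] by simp
  ultimately have le: "x * real (Suc n) powr (- 1 / 4) \<le> 1 / 2"
    by (simp add: powr_minus_divide field_simps del: of_nat_Suc)
  have "fact (Suc n) powr (- 1 / 4) * x ^ Suc n
      = (x * real (Suc n) powr (- 1 / 4)) * (fact n powr (- 1 / 4) * x ^ n)"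
    by (simp add: powr_mult del: of_nat_Suc)
  also have "\<dots> \<le> 1 / 2 * (fact n powr (- 1 / 4) * x ^ n)"
    using assms by (intro mult_right_mono[OF le]) auto
  finally show "norm (fact (Suc n) powr (- 1 / 4) * x ^ Suc n) \<le> 1 / 2 * norm (fact n powr (- 1 / 4) * x ^ n)"
    using assms by (simp add: abs_mult del: fact_Suc)
qed simp

section \<open>An entire function without superposition\<close>

lemma entire_without_superposition:
  "\<exists>\<phi>. \<phi> holomorphic_on UNIV \<and> \<not> defines_superposition_operator \<phi>"
proof -
  define c :: "nat \<Rightarrow> real" where "c k = fact k powr (- 1 / 4)" for k
  have c0: "c k \<ge> 0" for k by (simp add: c_def)
  have c_entire: "summable (\<lambda>k. cmod (of_real (c k)) * x ^ k)" if "x \<ge> 0" for x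
    using summable_fact_powr[OF that] by (simp add: c_def)
  define \<phi> where "\<phi> = (\<lambda>z::complex. \<Sum>k. of_real (c k) * z ^ k)"
  define f where "f n = real n powr (- 1 / 2)" for n
  define a :: "nat \<Rightarrow> complex" where "a = (\<lambda>n. of_real (f n))"
  have "sqterm a \<sigma> summable_on {1..}" if "\<sigma> > 0" for \<sigma>
  proof -
    have "sqterm a \<sigma> n = real n powr (- 1 - 2 * \<sigma>)" if "n \<ge> 1" for n
    proof -
      have "cmod (a n) = real n powr (- 1 / 2)" unfolding a_def norm_of_real by (simp add: f_def)
      then have "(cmod (a n))\<^sup>2 = real n powr (- 1)" using that by (simp only: powr_power) simp
      then show ?thesis by (simp only: powr_add[symmetric]) simp
    qed
    moreover have "(\<lambda>n. real n powr (- 1 - 2 * \<sigma>)) summable_on {1..}"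
      using that by (intro summable_on_powr) simp
    ultimately show ?thesis by (subst summable_on_cong) auto
  qed
  then have a: "a \<in> H_plus" by (simp add: H_plus_def)
  define \<beta> where "\<beta> = (\<lambda>n. \<Sum>\<^sub>\<infinity>k. of_real (c k) * dpow a k n)"
  have lower: "fact m powr (1 / 4) \<le> cmod (\<beta> (fact m))" for m
  proof -
    let ?n = "fact m :: nat"
    have n1: "?n \<ge> 1" by (rule fact_ge_1)
    have "dpow (\<lambda>n. 1 * f n) k ?n = dpow (\<lambda>_. 1) k ?n * f ?n" for k
      by (rule dpow_mult) (use n1 in \<open>auto simp: f_def powr_mult\<close>)
    then have dp: "dpow f k ?n = dpow (\<lambda>_. 1) k ?n * f ?n" for k by simp
    have dp0: "dpow f k n \<ge> 0" for k n by (rule dpow_ge_0) (simp add: f_def)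
    have "(\<lambda>k. cmod (of_real (c k) * dpow a k ?n)) summable_on UNIV"
      using superposition_series(1)[OF a c_entire n1] by simp
    then have sm: "(\<lambda>k. c k * dpow f k ?n) summable_on UNIV"
      using c0 dp0 by (simp add: a_def dpow_of_real norm_mult)
    have "\<beta> ?n = (\<Sum>\<^sub>\<infinity>k. of_real (c k * dpow f k ?n))"
      by (simp add: \<beta>_def a_def dpow_of_real)
    also have "\<dots> = of_real (\<Sum>\<^sub>\<infinity>k. c k * dpow f k ?n)"
      by (rule infsumI[OF has_sum_of_real[OF has_sum_infsum[OF sm]]])
    finally have "\<beta> ?n = of_real (\<Sum>\<^sub>\<infinity>k. c k * dpow f k ?n)" .
    then have "cmod (\<beta> ?n) = (\<Sum>\<^sub>\<infinity>k. c k * dpow f k ?n)"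
      using c0 dp0 by (simp add: infsum_nonneg)
    \<comment> \<open>All terms are nonnegative, so nothing cancels and the single index k = m
      bounds the coefficient from below.\<close>
    also have "\<dots> \<ge> c m * dpow f m ?n"
      using finite_sum_le_infsum[OF sm, of "{m}"] c0 dp0 by simp
    also have "c m * dpow f m ?n \<ge> c m * (fact m * f ?n)"
      unfolding dp by (intro mult_left_mono mult_right_mono fact_le_dpow_one_fact c0) (simp add: f_def)
    \<comment> \<open>With n = m!, the factors are n^(-1/4) from c, n from the number of
      factorizations and n^(-1/2) from f: in total n^(1/4).\<close>
    also have "c m * (fact m * f ?n) = fact m powr (- 1 / 4 + 1 + - 1 / 2)"
      by (simp only: powr_add) (simp add: c_def f_def)
    finally show ?thesis by simp
  qed
  have "\<not> defines_superposition_operator \<phi>"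
  proof
    assume "defines_superposition_operator \<phi>"
    then obtain b where b: "b \<in> H_plus"
      and eq: "\<And>s. s \<in> half_plane (1 / 2) \<Longrightarrow> (\<phi> \<circ> dirichlet_series a) s = dirichlet_series b s"
      using a unfolding defines_superposition_operator_def by blast
    \<comment> \<open>Some other coefficient sequence might a priori represent the composition;
      uniqueness identifies any such b with \<beta>.\<close>
    have b\<beta>: "b n - \<beta> n = 0" if "n \<ge> 1" for n
    proof (rule dirichlet_series_eq_0_imp[where c = "\<lambda>n. b n - \<beta> n", OF _ _ that])
      fix s :: real assume s: "s \<ge> 1"
      then have hs: "((\<lambda>n. \<beta> n * of_nat n powr (- of_real s)) has_sum \<phi> (dirichlet_series a (of_real s))) {1..}"
        using superposition_series(2)[OF a c_entire, of "of_real s"] by (simp add: \<beta>_def \<phi>_def)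
      have "(\<lambda>n. b n * of_nat n powr (- of_real s)) summable_on {1..}"
        by (rule Infinite_Sum.abs_summable_summable[OF H_plus_abs_summable[OF b]]) (use s in simp)
      then have "((\<lambda>n. b n * of_nat n powr (- of_real s)) has_sum dirichlet_series b (of_real s)) {1..}"
        unfolding dirichlet_series_def by (rule has_sum_infsum)
      moreover have "((\<lambda>n. - (\<beta> n * of_nat n powr (- of_real s))) has_sum - \<phi> (dirichlet_series a (of_real s))) {1..}"
        using hs by (simp add: has_sum_uminus)
      ultimately have "((\<lambda>n. b n * of_nat n powr (- of_real s) + - (\<beta> n * of_nat n powr (- of_real s))) has_sum
          dirichlet_series b (of_real s) + - \<phi> (dirichlet_series a (of_real s))) {1..}"
        by (rule has_sum_add)
      then have d: "((\<lambda>n. (b n - \<beta> n) * of_nat n powr (- of_real s)) has_sum 0) {1..}"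
        using eq[of "of_real s"] s by (simp add: half_plane_def left_diff_distrib)
      show "dirichlet_series (\<lambda>n. b n - \<beta> n) (of_real s) = 0"
        unfolding dirichlet_series_def by (rule infsumI[OF d])
      \<comment> \<open>For complex terms unordered summability is already absolute
        summability.\<close>
      show "(\<lambda>n. cmod ((b n - \<beta> n) * of_nat n powr (- of_real s))) summable_on {1..}"
        using has_sum_imp_summable[OF d] by (simp only: summable_on_iff_abs_summable_on_complex)
    qed
    \<comment> \<open>At \<sigma> = 1/8 the term at n = m! is at least n^(1/2) n^(-1/4) = n^(1/4),
      which is unbounded, while each term is at most B.\<close>
    have "(1 / 8 :: real) > 0" by simp
    then have sb: "sqterm b (1 / 8) summable_on {1..}" using b unfolding H_plus_def by blast
    define B where "B = sqnorm b (1 / 8)"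
    have "fact m \<le> B ^ 4" for m
    proof -
      let ?n = "fact m :: nat"
      have n1: "?n \<ge> 1" by (rule fact_ge_1)
      have "fact m powr (1 / 4) = (fact m powr (1 / 4))\<^sup>2 * real ?n powr (- 2 * (1 / 8))"
        by (simp add: powr_power powr_add[symmetric])
      also have "\<dots> \<le> sqterm b (1 / 8) ?n"
        using lower[of m] b\<beta>[OF n1] by (intro mult_right_mono power_mono) auto
      also have "\<dots> \<le> B"
        using finite_sum_le_infsum[OF sb, of "{?n}"] n1 by (simp add: B_def)
      finally have "(fact m powr (1 / 4)) ^ 4 \<le> B ^ 4" by (rule power_mono) simp
      then show ?thesis by (simp add: powr_power)
    qed
    moreover obtain m where "B ^ 4 < real m" using reals_Archimedean2 by blast
    moreover have "real m \<le> fact m"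
      using fact_ge_self[of m] by (metis of_nat_fact of_nat_mono)
    ultimately show False by (meson leD order_trans)
  qed
  moreover have "\<phi> holomorphic_on UNIV"
    unfolding \<phi>_def by (rule entire_power_series(1)[OF c_entire])
  ultimately show ?thesis by blast
qed

theorem theorem5p5:
  "(\<exists>\<phi>. \<phi> holomorphic_on UNIV \<and> (\<nexists>p. \<phi> = poly p) \<and> defines_superposition_operator \<phi>)
   \<and> \<not> (\<forall>\<phi>. \<phi> holomorphic_on UNIV \<longrightarrow> defines_superposition_operator \<phi>)"
  using entire_nonpolynomial_superposition entire_without_superposition by blast

end
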